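(* Let $G$ be a connected finite simple graph with an even number $n$ of vertices. Then $G$ contains a perfect forest.
   Context: A spanning subgraph $F$ of a graph $G$ is called a perfect forest if (i) $F$ is a forest, (ii) the degree $d_F(x)$ of every vertex $x \in V(F)=V(G)$ in $F$ is odd, and (iii) each tree (connected component) of $F$ is an induced subgraph of $G$. *)

theory Defs
  imports "Graph_Theory.Graph_Theory"
begin

text \<open>
  Finite simple graphs are modelled by the locale \<^locale>\<open>pair_graph\<close>: a finite vertex set
  with a symmetric irreflexive arc relation, where an undirected edge \<open>uv\<close> is the pair of
  arcs \<open>(u,v)\<close>, \<open>(v,u)\<close>.

  In this model traversing an edge back and forth is a \<open>cycle\<close> of length 2 in the sense of
  digraphs, so \<^const>\<open>forest\<close> holds only for edgeless graphs. The cycles of the underlying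
  undirected simple graph are exactly the digraph cycles of length at least 3.
\<close>

definition undirected_forest :: "'a pair_pre_digraph \<Rightarrow> bool" where
  "undirected_forest F \<longleftrightarrow>
     (\<nexists>p. pre_digraph.cycle (with_proj F) p \<and> 3 \<le> length p)"

text \<open>
  Since \<open>F\<close> is symmetric, \<^const>\<open>out_degree\<close> is the undirected vertex degree, and the strongly
  connected components \<^const>\<open>pre_digraph.sccs\<close> are the connected components.
\<close>

definition perfect_forest :: "'a pair_pre_digraph \<Rightarrow> 'a pair_pre_digraph \<Rightarrow> bool" where
  "perfect_forest F G \<longleftrightarrow>
     pair_graph F \<and>
     spanning (with_proj F) (with_proj G) \<and>
     undirected_forest F \<and>
     (\<forall>x \<in> pverts F. odd (out_degree (with_proj F) x)) \<and>
     (\<forall>T \<in> pre_digraph.sccs (with_proj F). induced_subgraph T (with_proj G))"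

end

theory Submission
  imports Defs
begin

text \<open>
  Since \<open>G\<close> is connected of even order, it has a spanning subgraph with all degrees odd; take one,
  \<open>F\<close>, with as few edges as possible. If \<open>xy\<close> is an edge of \<open>G\<close>, then \<open>x\<close> and \<open>y\<close> are not connected
  in \<open>F - xy\<close>: otherwise some \<open>P \<subseteq> F - xy\<close> has exactly \<open>x\<close> and \<open>y\<close> as odd vertices, hence at
  least two edges, and toggling the edges of \<open>P\<close> and the edge \<open>xy\<close> in \<open>F\<close> preserves all parities
  but loses an edge. For \<open>xy \<in> F\<close> this excludes cycles, for \<open>xy \<notin> F\<close> it says that the components
  of \<open>F\<close> are induced.
\<close>

text \<open>A symmetric irreflexive relation stands for an undirected edge set. The image of
  \<open>{x}\<close> is then the neighbourhood of \<open>x\<close>, so a symmetric \<open>P\<close>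
  with \<open>odd_verts P = T\<close> is a T-join.\<close>

definition odd_verts :: "'a rel \<Rightarrow> 'a set" where
  "odd_verts R = {x. odd (card (R `` {x}))}"

lemma odd_card_sym_diff:
  assumes "finite A" "finite B"
  shows "odd (card (sym_diff A B)) \<longleftrightarrow> odd (card A) \<noteq> odd (card B)"
proof -
  have "card (sym_diff A B) = card (A - B) + card (B - A)"
    using assms by (intro card_Un_disjoint) auto
  moreover have "card A = card (A - B) + card (A \<inter> B)"
    using assms(1) by (metis Int_Diff_disjoint Int_commute Un_Diff_Int card_Un_disjoint finite_Diff finite_Int)
  moreover have "card B = card (B - A) + card (A \<inter> B)"
    using assms(2) by (metis Int_Diff_disjoint Int_commute Un_Diff_Int card_Un_disjoint finite_Diff finite_Int)
  ultimately show ?thesis by presburger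
qed

text \<open>Taking the image of a point commutes with symmetric difference, and parity of size is
  additive. So \<open>odd_verts\<close> is linear over GF(2), which is what allows edge sets to be
  toggled.\<close>

lemma odd_verts_sym_diff:
  assumes "finite A" "finite B"
  shows "odd_verts (sym_diff A B) = sym_diff (odd_verts A) (odd_verts B)"
proof -
  have "sym_diff A B `` {x} = sym_diff (A `` {x}) (B `` {x})" for x by auto
  moreover have "finite (A `` {x})" "finite (B `` {x})" for x
    using assms by (auto intro: finite_Image)
  ultimately show ?thesis by (auto simp: odd_verts_def odd_card_sym_diff)
qed

lemma odd_verts_empty [simp]: "odd_verts {} = {}"
  by (simp add: odd_verts_def)

lemma odd_verts_edge:
  assumes "x \<noteq> y"
  shows "odd_verts {(x, y), (y, x)} = {x, y}"
proof -
  have "{(x, y), (y, x)} `` {z} = (if z = x then {y} else if z = y then {x} else {})" for z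
    using assms by auto
  then show ?thesis by (auto simp: odd_verts_def)
qed

lemma sym_sym_diff: "sym A \<Longrightarrow> sym B \<Longrightarrow> sym (sym_diff A B)"
  unfolding sym_def by blast

text \<open>Sum the edges of a walk mod 2: contributions at inner vertices cancel. The form
  \<open>sym_diff {u} {v}\<close> is empty for \<open>u = v\<close>, so closed walks fit in and no
  simple path has to be extracted.\<close>

lemma exists_join_rtrancl:
  assumes "finite E" "sym E" "(u, v) \<in> E\<^sup>*"
  obtains P where "P \<subseteq> E" "sym P" "odd_verts P = sym_diff {u} {v}"
proof -
  from assms(3) have "\<exists>P \<subseteq> E. sym P \<and> odd_verts P = sym_diff {u} {v}"
  proof induction
    case base
    have "odd_verts {} = sym_diff {u} {u}" by simp
    then show ?case by (meson empty_subsetI sym_def empty_iff)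
  next
    case (step y z)
    then obtain P where P: "P \<subseteq> E" "sym P" "odd_verts P = sym_diff {u} {y}" by blast
    show ?case
    proof (cases "y = z")
      \<comment> \<open>\<open>E\<close> may contain loops here; a loop does not move the endpoint,
        so \<open>P\<close> is kept.\<close>
      case True
      with P show ?thesis by blast
    next
      case False
      let ?e = "{(y, z), (z, y)}"
      have "finite P" using P(1) assms(1) by (rule finite_subset)
      then have "odd_verts (sym_diff P ?e) = sym_diff (sym_diff {u} {y}) {y, z}"
        using P(3) odd_verts_edge[OF False] by (simp add: odd_verts_sym_diff)
      also have "\<dots> = sym_diff {u} {z}" using False by auto
      finally have "odd_verts (sym_diff P ?e) = sym_diff {u} {z}" .
      moreover have "sym_diff P ?e \<subseteq> E" using P(1) step.hyps(2) assms(2) by (auto dest: symD)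
      moreover have "sym (sym_diff P ?e)"
        by (intro sym_sym_diff P(2)) (auto simp: sym_def)
      ultimately show ?thesis by blast
    qed
  qed
  then show ?thesis using that by blast
qed

text \<open>The points of \<open>T\<close> are paired off: a walk joins two of them, induction
  handles the others, and the two joins are added mod 2, where common edges cancel without affecting
  parities.\<close>

lemma exists_join:
  assumes "finite E" "sym E" "finite T" "even (card T)"
    and "\<And>u v. u \<in> T \<Longrightarrow> v \<in> T \<Longrightarrow> (u, v) \<in> E\<^sup>*"
  shows "\<exists>P \<subseteq> E. sym P \<and> odd_verts P = T"
  using assms(3-)
proof (induction "card T" arbitrary: T rule: less_induct)
  case less
  show ?case
  proof (cases "T = {}")
    case True
    then show ?thesis by (meson empty_subsetI odd_verts_empty sym_def empty_iff)
  next
    case False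
    then obtain u where u: "u \<in> T" by blast
    have "T \<noteq> {u}" using less.prems(2) by auto
    then obtain v where v: "v \<in> T" "u \<noteq> v" using u by blast
    have "card T = Suc (Suc (card (T - {u, v})))"
      using u v less.prems(1) by (metis Diff_insert2 card.remove finite_Diff insert_Diff insert_iff)
    then have "\<exists>P \<subseteq> E. sym P \<and> odd_verts P = T - {u, v}"
      using less.prems by (intro less.hyps) auto
    then obtain P where P: "P \<subseteq> E" "sym P" "odd_verts P = T - {u, v}" by blast
    obtain Q where Q: "Q \<subseteq> E" "sym Q" "odd_verts Q = sym_diff {u} {v}"
      using exists_join_rtrancl[OF assms(1,2) less.prems(3)[OF u v(1)]] .
    have "odd_verts (sym_diff P Q) = sym_diff (T - {u, v}) (sym_diff {u} {v})"
      using P Q assms(1) by (simp add: odd_verts_sym_diff finite_subset)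
    also have "\<dots> = T" using u v by auto
    finally have "odd_verts (sym_diff P Q) = T" .
    moreover have "sym_diff P Q \<subseteq> E" using P(1) Q(1) by auto
    moreover have "sym (sym_diff P Q)" using P(2) Q(2) by (rule sym_sym_diff)
    ultimately show ?thesis by blast
  qed
qed

lemma minimum_join_disconnected:
  assumes fin: "finite E" and "sym E" "irrefl E" "R \<subseteq> E" "sym R"
    and min: "\<And>R'. R' \<subseteq> E \<Longrightarrow> sym R' \<Longrightarrow> odd_verts R' = odd_verts R \<Longrightarrow> card R \<le> card R'"
    and xy: "(x, y) \<in> E"
  shows "(x, y) \<notin> (R - {(x, y), (y, x)})\<^sup>*"
proof
  let ?e = "{(x, y), (y, x)}"
  have neq: "x \<noteq> y" using xy \<open>irrefl E\<close> by (auto simp: irrefl_def)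
  assume "(x, y) \<in> (R - ?e)\<^sup>*"
  moreover have "sym (R - ?e)" using \<open>sym R\<close> by (auto simp: sym_def)
  moreover have finR: "finite R" using \<open>R \<subseteq> E\<close> fin by (rule finite_subset)
  ultimately obtain P where P: "P \<subseteq> R - ?e" "sym P" "odd_verts P = sym_diff {x} {y}"
    using exists_join_rtrancl[of "R - ?e" x y] by blast
  have finP: "finite P" using P(1) finR by (meson finite_Diff finite_subset)
  have odds: "x \<in> odd_verts P" "y \<in> odd_verts P" using P(3) neq by auto
  then have "P `` {x} \<noteq> {}" "P `` {y} \<noteq> {}" unfolding odd_verts_def
    by (metis (mono_tags, lifting) card.empty even_zero mem_Collect_eq)+
  then obtain a b where ab: "(x, a) \<in> P" "(y, b) \<in> P" by blast
  \<comment> \<open>\<open>card\<close> counts arcs, so \<open>P\<close> has to beat the two arcs of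
    \<open>?e\<close>. The edge \<open>xy\<close> is not in \<open>P\<close>, hence
    \<open>a \<noteq> y\<close>, and these three arcs are distinct.\<close>
  have "{(x, a), (a, x), (y, b)} \<subseteq> P" using ab P(2) by (auto dest: symD)
  moreover have "card {(x, a), (a, x), (y, b)} = 3"
  proof -
    have "a \<noteq> x" "a \<noteq> y" using ab(1) P(1) \<open>R \<subseteq> E\<close> \<open>irrefl E\<close> by (auto simp: irrefl_def)
    then show ?thesis using neq by auto
  qed
  ultimately have "3 \<le> card P" using finP card_mono by metis
  let ?R' = "sym_diff (sym_diff R P) ?e"
  have "odd_verts ?R' = sym_diff (sym_diff (odd_verts R) {x, y}) {x, y}"
    using P(3) neq finR finP odd_verts_edge[OF neq] by (simp add: odd_verts_sym_diff insert_commute)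
  then have "odd_verts ?R' = odd_verts R" by auto
  moreover have "?R' \<subseteq> E" using P(1) \<open>R \<subseteq> E\<close> \<open>sym E\<close> xy by (auto dest: symD)
  moreover have "sym ?R'" by (intro sym_sym_diff \<open>sym R\<close> P(2)) (auto simp: sym_def)
  ultimately have "card R \<le> card ?R'" by (intro min)
  \<comment> \<open>Toggling \<open>P\<close> only deletes, as \<open>P\<close> lies inside
    \<open>R\<close>. The bound holds whether toggling \<open>xy\<close> adds or removes it.\<close>
  also have "?R' \<subseteq> (R - P) \<union> ?e" using P(1) by auto
  then have "card ?R' \<le> card (R - P) + card ?e"
    by (meson card_Un_le card_mono finR finite.emptyI finite.insertI finite_Diff finite_UnI le_trans)
  also have "card (R - P) = card R - card P" using P(1) finP by (intro card_Diff_subset) auto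
  also have "card ?e = 2" using neq by simp
  finally show False using \<open>3 \<le> card P\<close> P(1) finR card_mono[of R P] by fastforce
qed

text \<open>Both ends of each arc of a walk are visited, so no arc touches \<open>v\<close>. This
  serves for the part of a cycle away from one of its vertices.\<close>

lemma (in pair_wf_digraph) awalk_avoiding_vertex_rtrancl:
  assumes "awalk u p w" "v \<notin> set (awalk_verts u p)"
  shows "(u, w) \<in> {e \<in> parcs G. fst e \<noteq> v \<and> snd e \<noteq> v}\<^sup>*"
  using assms
proof (induction p arbitrary: u)
  case Nil
  then show ?case by (simp add: awalk_Nil_iff)
next
  case (Cons e p)
  from Cons.prems have e: "e \<in> parcs G" "fst e = u" and p: "awalk (snd e) p w"
    by (auto simp: awalk_Cons_iff)
  have "snd e \<in> set (awalk_verts (snd e) p)" by (cases p) (use p in \<open>auto simp: awalk_Cons_iff\<close>)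
  with Cons.prems(2) e have "(u, snd e) \<in> {e \<in> parcs G. fst e \<noteq> v \<and> snd e \<noteq> v}" by auto
  moreover have "(snd e, w) \<in> {e \<in> parcs G. fst e \<noteq> v \<and> snd e \<noteq> v}\<^sup>*"
    using Cons.prems(2) by (intro Cons.IH p) auto
  ultimately show ?case by (rule converse_rtrancl_into_rtrancl)
qed

text \<open>A cycle starting \<open>u\<close>, \<open>v\<close>, \<open>w\<close> returns from
  \<open>w\<close> to \<open>u\<close> without meeting \<open>v\<close> again; preceded by
  \<open>vw\<close>, this is a detour around the edge \<open>uv\<close>.\<close>

lemma (in pair_wf_digraph) cycle_bypass_edge:
  assumes "cycle p" "3 \<le> length p"
  obtains x y where "(x, y) \<in> parcs G" "(y, x) \<in> (parcs G - {(x, y), (y, x)})\<^sup>*"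
proof -
  from assms(1) obtain u where u: "awalk u p u" "distinct (tl (awalk_verts u p))"
    by (auto simp: cycle_def)
  from assms(2) obtain e f r where p: "p = e # f # r" "r \<noteq> []"
    by (auto simp: Suc_le_length_iff numeral_3_eq_3)
  define v w where "v = snd e" and "w = snd f"
  have *: "e \<in> parcs G \<and> u = fst e \<and> f \<in> parcs G \<and> v = fst f \<and> awalk w r u"
    using u(1) unfolding p(1) awalk_Cons_iff v_def w_def .
  then have r: "awalk w r u" by (elim conjE)
  from * have e: "e = (u, v)" and f: "f = (v, w)"
    by (simp_all add: v_def w_def prod_eq_iff)
  have uv: "(u, v) \<in> parcs G" using * unfolding e by (elim conjE)
  have vw: "(v, w) \<in> parcs G" using * unfolding f by (elim conjE)
  \<comment> \<open>Without the initial \<open>u\<close>, the vertices of the cycle are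
    \<open>v\<close> followed by those of \<open>r\<close>.\<close>
  have d: "v \<notin> set (awalk_verts w r)" "distinct (awalk_verts w r)"
    using u(2) p(1) e f by auto
  \<comment> \<open>A nonempty walk with distinct vertices is not closed. Length at least 3 enters
    here: with \<open>w = u\<close>, the arc \<open>vw\<close> would be the edge \<open>uv\<close>
    traversed back.\<close>
  have "w \<noteq> u"
    using r d(2) p(2) by (metis apath_def apath_nonempty_ends)
  let ?S = "{e \<in> parcs G. fst e \<noteq> v \<and> snd e \<noteq> v}"
  have "?S \<subseteq> parcs G - {(u, v), (v, u)}" by auto
  then have "(w, u) \<in> (parcs G - {(u, v), (v, u)})\<^sup>*"
    using awalk_avoiding_vertex_rtrancl[OF r d(1)] rtrancl_mono by blast
  moreover have "(v, w) \<in> parcs G - {(u, v), (v, u)}"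
    using vw \<open>w \<noteq> u\<close> d(1) hd_in_awalk_verts(1)[OF r] by auto
  ultimately show ?thesis using that uv by (meson converse_rtrancl_into_rtrancl)
qed

lemma reachable_with_proj_rtrancl:
  "u \<rightarrow>\<^sup>*\<^bsub>with_proj H\<^esub> v \<Longrightarrow> (u, v) \<in> (parcs H)\<^sup>*"
  by (auto simp: reachable_def dest: rtrancl_on_rtranclI)

theorem theorem1:
  fixes G :: "'a pair_pre_digraph" and n :: nat
  assumes "pair_graph G"
    and "connected (with_proj G)"
    and "card (pverts G) = n"
    and "even n"
  shows "\<exists>F. perfect_forest F G"
proof -
  interpret G: pair_graph G by fact
  let ?E = "parcs G"
  have fin: "finite ?E" by (rule G.pair_finite_arcs)
  have symE: "sym ?E" using G.pair_sym_arcs by (simp add: symmetric_def)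
  have irreflE: "irrefl ?E" using G.pair_no_loops by (force simp: irrefl_def)
  have "strongly_connected (with_proj G)"
    by (rule G.symmetric_connected_imp_strongly_connected[OF G.pair_sym_arcs assms(2)])
  then have "(u, v) \<in> ?E\<^sup>*" if "u \<in> pverts G" "v \<in> pverts G" for u v
    using that by (auto simp: strongly_connected_def intro: reachable_with_proj_rtrancl)
  \<comment> \<open>Take all vertices as \<open>T\<close>: \<open>n\<close> even gives its parity,
    connectedness the walks.\<close>
  then have ex: "\<exists>R. R \<subseteq> ?E \<and> sym R \<and> odd_verts R = pverts G"
    using exists_join[OF fin symE G.pair_finite_verts] assms(3,4) by blast
  \<comment> \<open>Each edge counts as two arcs, so minimal \<open>card\<close> means fewest
    edges.\<close>
  define R where "R = arg_min card (\<lambda>R. R \<subseteq> ?E \<and> sym R \<and> odd_verts R = pverts G)"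
  have R: "R \<subseteq> ?E" "sym R" "odd_verts R = pverts G"
    using arg_min_natI[of "\<lambda>R. R \<subseteq> ?E \<and> sym R \<and> odd_verts R = pverts G" _ card] ex
    unfolding R_def by blast+
  have min: "card R \<le> card R'" if "R' \<subseteq> ?E" "sym R'" "odd_verts R' = odd_verts R" for R'
    unfolding R_def using that R(3) by (intro arg_min_nat_le) auto
  have disconnected: "(x, y) \<notin> (R - {(x, y), (y, x)})\<^sup>*" if "(x, y) \<in> ?E" for x y
    using minimum_join_disconnected[OF fin symE irreflE R(1,2) min that] .
  define F where "F = \<lparr>pverts = pverts G, parcs = R\<rparr>"
  have F [simp]: "pverts F = pverts G" "parcs F = R" by (simp_all add: F_def)
  interpret F: pair_graph F
  proof
    show "finite (parcs F)" using R(1) fin by (simp add: finite_subset)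
    show "symmetric (with_proj F)" using R(2) by (simp add: symmetric_def)
  qed (use R(1) G.pair_finite_verts G.pair_no_loops in \<open>auto dest: G.wellformed'[OF subsetD[OF R(1)]]\<close>)
  have "subgraph (with_proj F) (with_proj G)"
    using R(1) F.wf_digraph G.wf_digraph by (simp add: subgraph_def compatible_def)
  moreover have "undirected_forest F"
    unfolding undirected_forest_def
  proof (intro notI, elim exE conjE)
    fix p assume "F.cycle p" "3 \<le> length p"
    then obtain x y where "(x, y) \<in> R" "(y, x) \<in> (R - {(x, y), (y, x)})\<^sup>*"
      using F.cycle_bypass_edge by auto
    \<comment> \<open>The detour runs from \<open>y\<close> to \<open>x\<close>, hence the swapped
      arguments.\<close>
    then show False using disconnected[of y x] R(1) symE by (auto simp: insert_commute dest: symD)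
  qed
  moreover have "odd (out_degree (with_proj F) x)" if "x \<in> pverts F" for x
  proof -
    have "out_arcs (with_proj F) x = Pair x ` (R `` {x})" by (auto simp: out_arcs_def)
    then have "out_degree (with_proj F) x = card (R `` {x})"
      by (simp add: out_degree_def card_image inj_on_def)
    then show ?thesis using that R(3) by (auto simp: odd_verts_def)
  qed
  moreover have "induced_subgraph T (with_proj G)" if "T \<in> F.sccs" for T
  proof -
    have ind: "induced_subgraph T (with_proj F)" and sc: "strongly_connected T"
      using that by (auto simp: F.sccs_def)
    then have sub: "subgraph T (with_proj F)" by (simp add: induced_subgraph_def)
    \<comment> \<open>\<open>T\<close> already has all arcs of \<open>F\<close> between its
      vertices, so only the edges of \<open>G\<close> inside \<open>verts T\<close> remain to be
      placed in \<open>R\<close>.\<close>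
    have "(x, y) \<in> R" if "(x, y) \<in> ?E" "x \<in> verts T" "y \<in> verts T" for x y
    proof (rule ccontr)
      assume "(x, y) \<notin> R"
      have "x \<rightarrow>\<^sup>*\<^bsub>T\<^esub> y" using sc that(2,3) by (simp add: strongly_connected_def)
      then have "x \<rightarrow>\<^sup>*\<^bsub>with_proj F\<^esub> y" using sub by (rule F.reachable_mono)
      then have "(x, y) \<in> R\<^sup>*" using reachable_with_proj_rtrancl by fastforce
      \<comment> \<open>Deleting the absent edge changes nothing, so \<open>disconnected\<close>
        speaks about \<open>F\<close> itself.\<close>
      moreover have "R - {(x, y), (y, x)} = R" using \<open>(x, y) \<notin> R\<close> R(2) by (auto dest: symD)
      ultimately show False using disconnected[OF that(1)] by simp
    qed
    then show ?thesis
      using ind R(1) G.wf_digraph by (auto simp: induced_subgraph_def subgraph_def compatible_def)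
  qed
  ultimately show ?thesis
    using F.pair_graph by (auto simp: perfect_forest_def spanning_def)
qed

end
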